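(* Let $K/\mathbb{Q}$ and $L/K$ be two field extensions of degree $2$ and let $a,b,c,d \in L$. Let $\sigma$ be the non-trivial element of the Galois group $\mathrm{Gal}(L/K)$. Define $$ C = \left\{ \begin{pmatrix} ax & b\,\sigma(x) \\ cy & d\,\sigma(y) \end{pmatrix} \;:\; x,y \in \mathcal{O}_{L}\setminus\{0\} \right\}. $$ There exists a matrix in $C$ with zero determinant if and only if $$ \begin{vmatrix} N_{L/K}(a) & N_{L/K}(b) \\ N_{L/K}(c) & N_{L/K}(d) \end{vmatrix} = 0 . $$
   Context: $\mathcal{O}_L$ denotes the ring of algebraic integers of the number field $L$, and $N_{L/K}$ denotes the relative norm of the extension $L/K$, i.e. $N_{L/K}(z)=z\,\sigma(z)$. *)

theory Defs
  imports "Jordan_Normal_Form.Determinant"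
begin

text \<open>
  A field extension is given by an embedding \<open>\<iota> :: 'k \<Rightarrow> 'l\<close> between types of fields
  (\<open>field_hom \<iota>\<close>); for an extension of the rationals this embedding is \<open>of_rat\<close>.
\<close>

lemma vector_space_field_hom:
  assumes "field_hom (\<iota> :: 'k::field \<Rightarrow> 'l::field)"
  shows "vector_space (\<lambda>k x. \<iota> k * x)"
proof -
  interpret field_hom \<iota> by fact
  show ?thesis by unfold_locales (simp_all add: algebra_simps hom_distribs)
qed

text \<open>
  An infinite-dimensional space has \<open>dim\<close> equal to 0, so a positive value does express
  that the extension is finite of that degree. The value is meaningful only if \<open>\<iota>\<close> is a
  field homomorphism.
\<close>

definition extension_degree :: "('k::field \<Rightarrow> 'l::field) \<Rightarrow> nat" where
  "extension_degree \<iota> = vector_space.dim (\<lambda>k x. \<iota> k * x) (UNIV :: 'l set)"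

definition galois_group :: "('k::field \<Rightarrow> 'l::field) \<Rightarrow> ('l \<Rightarrow> 'l) set" where
  "galois_group \<iota> = {\<tau>. field_isom \<tau> \<and> (\<forall>k. \<tau> (\<iota> k) = \<iota> k)}"

definition ring_of_integers :: "'l::field_char_0 set" where
  "ring_of_integers = {z. algebraic_int z}"

text \<open>
  The norm of a quadratic extension with non-trivial automorphism \<open>\<sigma>\<close>, as an element of the
  larger field (its value lies in the image of the smaller one).
\<close>

definition rel_norm :: "('l::field \<Rightarrow> 'l) \<Rightarrow> 'l \<Rightarrow> 'l" where
  "rel_norm \<sigma> z = z * \<sigma> z"

end

theory Submission
  imports Defs
begin

text \<open>
  With \<open>w = x * \<sigma> y\<close>, the determinant of a matrix in \<open>C\<close> vanishes iff
  \<open>a * d * w = b * c * \<sigma> w\<close>; taking norms gives one direction. Conversely, if \<open>a * d\<close> and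
  \<open>b * c\<close> have the same norm and are nonzero, Hilbert 90 provides such a \<open>w\<close> in \<open>L\<close>, and a
  nonzero integer multiple of it is an algebraic integer \<open>x\<close>, to be used with \<open>y = 1\<close>.
\<close>

lemma det_mat_of_rows_list_2:
  "det (mat_of_rows_list 2 [[p, q], [r, s]]) = p * s - q * (r :: 'a :: comm_ring_1)"
proof -
  let ?A = "mat_of_rows_list 2 [[p, q], [r, s]]"
  have A: "?A \<in> carrier_mat 2 2"
    by (intro carrier_matI) (simp_all add: mat_of_rows_list_def)
  have "det ?A = (\<Sum>j<2. ?A $$ (0, j) * cofactor ?A 0 j)"
    by (rule laplace_expansion_row[OF A]) simp
  also have "\<dots> = p * s - q * r"
    by (simp add: numeral_2_eq_2 cofactor_def mat_delete_def mat_of_rows_list_def det_single)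
  finally show ?thesis .
qed

text \<open>Scaling a root of an integral polynomial by its leading coefficient \<open>l\<close>
  clears the obstruction to being monic.\<close>

lemma algebraic_imp_multiple_algebraic_int:
  fixes x :: "'a :: field_char_0"
  assumes "algebraic x"
  obtains n :: int where "n \<noteq> 0" "algebraic_int (of_int n * x)"
proof -
  from assms obtain p where p: "\<And>i. coeff p i \<in> \<int>" "p \<noteq> 0" "poly p x = 0"
    by (elim algebraicE) blast
  define m where "m = degree p"
  \<comment> \<open>A nonzero constant has no root. Positivity makes \<open>m - 1\<close> a true
    predecessor, as the splitting of \<open>l ^ m\<close> into \<open>l ^ (m - 1) * l\<close> needs
    below.\<close>
  have m: "m > 0"
  proof (rule ccontr)
    assume "\<not> m > 0"
    then obtain k where "p = [:k:]" by (auto simp: m_def elim: degree_eq_zeroE)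
    with p(2,3) show False by simp
  qed
  obtain l where l: "coeff p m = of_int l"
    using p(1) Ints_cases by metis
  have "l \<noteq> 0"
    using p(2) l unfolding m_def by auto
  \<comment> \<open>\<open>q(Y) = l^(m - 1) * p(Y / l)\<close> is monic with integral coefficients.\<close>
  define q where "q = monom 1 m + (\<Sum>i<m. monom (coeff p i * of_int l ^ (m - 1 - i)) i)"
  have coeff_q: "coeff q i =
      (if i = m then 1 else if i < m then coeff p i * of_int l ^ (m - 1 - i) else 0)" for i
    by (simp add: q_def coeff_sum)
  have "degree q = m"
    by (rule antisym) (auto intro!: degree_le le_degree simp: coeff_q)
  have "poly q (of_int l * x) =
      of_int l ^ m * x ^ m + (\<Sum>i<m. of_int l ^ (m - 1) * (coeff p i * x ^ i))"
  proof -
    have "coeff p i * of_int l ^ (m - 1 - i) * (of_int l * x) ^ i =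
        of_int l ^ (m - 1) * (coeff p i * x ^ i)" if "i < m" for i
    proof -
      have "of_int l ^ (m - 1) = (of_int l ^ (m - 1 - i) * of_int l ^ i :: 'a)"
        using that by (simp flip: power_add)
      thus ?thesis by (simp add: power_mult_distrib)
    qed
    hence "(\<Sum>i<m. coeff p i * of_int l ^ (m - 1 - i) * (of_int l * x) ^ i) =
        (\<Sum>i<m. of_int l ^ (m - 1) * (coeff p i * x ^ i))"
      by (intro sum.cong) auto
    moreover have "poly q (of_int l * x) = of_int l ^ m * x ^ m +
        (\<Sum>i<m. coeff p i * of_int l ^ (m - 1 - i) * (of_int l * x) ^ i)"
      by (simp add: q_def poly_sum poly_monom power_mult_distrib)
    ultimately show ?thesis by simp
  qed
  also have "\<dots> = of_int l ^ (m - 1) * (\<Sum>i\<le>m. coeff p i * x ^ i)"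
  proof -
    have "of_int l ^ m = (of_int l ^ (m - 1) * of_int l :: 'a)"
      using m by (simp flip: power_Suc2)
    thus ?thesis
      by (simp add: sum_distrib_left l algebra_simps flip: lessThan_Suc_atMost)
  qed
  also have "\<dots> = 0"
    using p(3) by (simp add: poly_altdef m_def)
  finally have "algebraic_int (of_int l * x)"
    using p(1) by (intro algebraic_int.intros[of q])
      (auto simp: \<open>degree q = m\<close> coeff_q)
  with \<open>l \<noteq> 0\<close> show ?thesis by (rule that)
qed

text \<open>Extending 1 to a basis \<open>{1, z}\<close> gives a quadratic equation for
  \<open>z\<close>; completing the square removes its linear term. The pure square root is wanted
  because an automorphism over the base field can only change its sign.\<close>

lemma quadratic_extension_generator:
  fixes \<iota> :: "'k :: field_char_0 \<Rightarrow> 'l :: field_char_0"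
  assumes "field_hom \<iota>" and "extension_degree \<iota> = 2"
  obtains \<theta> r where "\<theta> \<noteq> 0" "\<theta>\<^sup>2 = \<iota> r" "\<And>v. \<exists>p q. v = \<iota> p + \<iota> q * \<theta>"
proof -
  interpret field_hom \<iota> by fact
  interpret V: vector_space "\<lambda>k x. \<iota> k * x"
    by (rule vector_space_field_hom) fact
  have span1: "V.span {x} = range (\<lambda>k. \<iota> k * x)" for x
    by (rule V.span_singleton)
  have ind1: "V.independent {1}"
    by (simp add: V.dependent_single)
  define B where "B = V.extend_basis {1}"
  have B: "1 \<in> B" "V.independent B" "V.span B = UNIV"
    using V.extend_basis_superset[OF ind1] V.independent_extend_basis[OF ind1]
      V.span_extend_basis[OF ind1] by (auto simp: B_def)
  have "card B = 2"
    using V.basis_card_eq_dim[of B UNIV] B assms(2) by (simp add: extension_degree_def)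
  then obtain z where z: "B = {1, z}" "z \<noteq> 1"
    using B(1) by (auto simp: card_2_iff)
  have z': "\<exists>p q. v = \<iota> p + \<iota> q * z" for v
  proof -
    have "v \<in> V.span {z, 1}" using B(3) z by (auto simp: insert_commute)
    then obtain q where "v - \<iota> q * z \<in> V.span {1}" by (auto simp: V.span_breakdown_eq)
    then obtain p where "v - \<iota> q * z = \<iota> p" by (auto simp: span1)
    hence "v = \<iota> p + \<iota> q * z" by (simp add: algebra_simps)
    thus ?thesis by blast
  qed
  have "z \<notin> V.span {1}"
    using B(2) z by (auto simp: insert_commute[of 1] V.independent_insert)
  hence z_notin: "z \<noteq> \<iota> k" for k by (auto simp: span1)
  obtain s t where st: "z\<^sup>2 = \<iota> s + \<iota> t * z" using z' by blast
  \<comment> \<open>The shift that completes the square in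
    \<open>z\<^sup>2 = \<iota> s + \<iota> t * z\<close>.\<close>
  define \<theta> where "\<theta> = z - \<iota> (t / 2)"
  show ?thesis
  proof (rule that)
    show "\<theta> \<noteq> 0" using z_notin by (auto simp: \<theta>_def)
    have "\<theta>\<^sup>2 = z\<^sup>2 - \<iota> (2 * (t / 2)) * z + (\<iota> (t / 2))\<^sup>2"
      by (simp add: \<theta>_def power2_diff hom_mult mult_ac hom_numeral
          del: nonzero_mult_div_cancel_left times_divide_eq_right)
    also have "\<dots> = \<iota> (s + (t / 2)\<^sup>2)"
      by (simp add: st hom_add hom_power)
    finally show "\<theta>\<^sup>2 = \<iota> (s + (t / 2)\<^sup>2)" .
    fix v
    obtain p q where "v = \<iota> p + \<iota> q * z" using z' by blast
    hence "v = \<iota> (p + q * (t / 2)) + \<iota> q * \<theta>"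
      by (simp only: \<theta>_def hom_add hom_mult right_diff_distrib) simp
    thus "\<exists>p q. v = \<iota> p + \<iota> q * \<theta>" by blast
  qed
qed

text \<open>This makes the Hilbert 90 solution algebraic, so that it can be scaled into the ring of
  integers.\<close>

lemma quadratic_tower_algebraic:
  fixes \<iota> :: "'k :: field_char_0 \<Rightarrow> 'l :: field_char_0" and z :: 'l
  assumes "extension_degree (of_rat :: rat \<Rightarrow> 'k) = 2"
    and "field_hom \<iota>" and "extension_degree \<iota> = 2"
  shows "algebraic z"
proof -
  interpret field_hom \<iota> by fact
  obtain \<theta> :: 'k and r where \<theta>: "\<theta>\<^sup>2 = of_rat r" "\<And>v. \<exists>p q. v = of_rat p + of_rat q * \<theta>"
    using of_rat_hom.field_hom_axioms assms(1)
    by (rule quadratic_extension_generator) blast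
  obtain \<eta> s where \<eta>: "\<eta>\<^sup>2 = \<iota> s" "\<And>v. \<exists>p q. v = \<iota> p + \<iota> q * \<eta>"
    using assms(2,3) by (rule quadratic_extension_generator) blast
  obtain p q where z: "z = \<iota> p + \<iota> q * \<eta>" using \<eta>(2) by blast
  \<comment> \<open>Squaring \<open>z - \<iota> p = \<iota> q * \<eta>\<close> gives a quadratic
    equation for \<open>z\<close> over K. Its constant and linear coefficients are split here into
    rational coordinates.\<close>
  obtain e1 e2 where e: "q\<^sup>2 * s - p\<^sup>2 = of_rat e1 + of_rat e2 * \<theta>" using \<theta>(2) by blast
  obtain f1 f2 where f: "2 * p = of_rat f1 + of_rat f2 * \<theta>" using \<theta>(2) by blast
  have rat: "\<iota> (of_rat x) = of_rat x" for x
    by (cases x) (simp add: of_rat_rat hom_distribs)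
  \<comment> \<open>Isolating \<open>\<theta>\<close> in the quadratic equation of \<open>z\<close> over \<open>K\<close> and squaring gives a
    monic rational quartic.\<close>
  have "z\<^sup>2 = \<iota> (q\<^sup>2 * s - p\<^sup>2) + \<iota> (2 * p) * z"
    using \<eta>(1) by (simp add: z hom_distribs algebra_simps power2_eq_square)
  also have "\<dots> = of_rat e1 + of_rat f1 * z + \<iota> \<theta> * (of_rat e2 + of_rat f2 * z)"
    unfolding e f by (simp add: hom_distribs rat algebra_simps)
  finally have "z\<^sup>2 - of_rat e1 - of_rat f1 * z = \<iota> \<theta> * (of_rat e2 + of_rat f2 * z)"
    by simp
  hence "(z\<^sup>2 - of_rat e1 - of_rat f1 * z)\<^sup>2 = (\<iota> \<theta>)\<^sup>2 * (of_rat e2 + of_rat f2 * z)\<^sup>2"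
    by (simp add: power_mult_distrib)
  also have "(\<iota> \<theta>)\<^sup>2 = of_rat r"
    using \<theta>(1) rat by (metis hom_power)
  finally have *: "(z\<^sup>2 - of_rat e1 - of_rat f1 * z)\<^sup>2 = of_rat r * (of_rat e2 + of_rat f2 * z)\<^sup>2" .
  \<comment> \<open>The coefficients, from the constant term upwards, of the difference of the two
    sides of \<open>*\<close> expanded in \<open>z\<close>.\<close>
  define P where "P = [:e1\<^sup>2 - r * e2\<^sup>2, 2 * e1 * f1 - 2 * r * e2 * f2,
    f1\<^sup>2 - 2 * e1 - r * f2\<^sup>2, - 2 * f1, 1:]"
  show ?thesis
  proof (rule algebraicI')
    show "coeff (map_poly of_rat P) i \<in> (\<rat> :: 'l set)" for i
      by (simp add: coeff_map_poly)
    show "map_poly of_rat P \<noteq> (0 :: 'l poly)"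
      by (simp add: P_def map_poly_pCons)
    show "poly (map_poly of_rat P) z = 0"
      using * by (simp add: P_def map_poly_pCons of_rat_add of_rat_diff of_rat_mult of_rat_power
          of_rat_minus algebra_simps power2_eq_square)
  qed
qed

text \<open>
  Every \<open>t = v + u * \<sigma> v\<close> satisfies the equation, and \<open>t\<close> cannot vanish for both
  \<open>v = 1\<close> and \<open>v = \<theta>\<close>.
\<close>

lemma hilbert90_quadratic:
  fixes \<sigma> :: "'l :: field_char_0 \<Rightarrow> 'l"
  assumes "field_hom \<sigma>" and invol: "\<And>v. \<sigma> (\<sigma> v) = v"
    and \<theta>: "\<sigma> \<theta> = - \<theta>" "\<theta> \<noteq> 0" and u: "u * \<sigma> u = 1"
  obtains t where "t \<noteq> 0" "u * \<sigma> t = t"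
proof -
  interpret field_hom \<sigma> by fact
  define w where "w v = v + u * \<sigma> v" for v
  have "u * \<sigma> (w v) = w v" for v
  proof -
    have "u * \<sigma> (w v) = u * \<sigma> v + u * \<sigma> u * v"
      by (simp add: w_def hom_distribs invol algebra_simps)
    thus ?thesis using u by (simp add: w_def)
  qed
  moreover have "w 1 \<noteq> 0 \<or> w \<theta> \<noteq> 0"
  proof (rule ccontr)
    assume "\<not> ?thesis"
    \<comment> \<open>The sign change of \<open>\<theta>\<close> makes the two conditions
      incompatible: one forces \<open>u = -1\<close>, the other \<open>u = 1\<close>.\<close>
    hence "1 + u = 0" "\<theta> * (1 - u) = 0" by (auto simp: w_def \<theta> algebra_simps)
    hence "u = -1" "u = 1" using \<theta>(2) by (auto simp: add_eq_0_iff2)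
    thus False by simp
  qed
  ultimately show ?thesis using that by blast
qed

theorem theorem3p1:
  fixes \<iota> :: "'k::field_char_0 \<Rightarrow> 'l::field_char_0"
    and \<sigma> :: "'l \<Rightarrow> 'l"
    and a b c d :: 'l
    and C :: "'l mat set"
  assumes "extension_degree (of_rat :: rat \<Rightarrow> 'k) = 2"
    and "field_hom \<iota>"
    and "extension_degree \<iota> = 2"
    and "\<sigma> \<in> galois_group \<iota>" and "\<sigma> \<noteq> id"
    and "C = {mat_of_rows_list 2 [[a * x, b * \<sigma> x],
                                  [c * y, d * \<sigma> y]] | x y.
                x \<in> ring_of_integers - {0} \<and> y \<in> ring_of_integers - {0}}"
  shows "(\<exists>M \<in> C. det M = 0) \<longleftrightarrow>
    det (mat_of_rows_list 2 [[rel_norm \<sigma> a, rel_norm \<sigma> b],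
                             [rel_norm \<sigma> c, rel_norm \<sigma> d]]) = 0"
proof -
  have \<sigma>: "field_hom \<sigma>" and fix\<iota>: "\<And>k. \<sigma> (\<iota> k) = \<iota> k"
    using assms(4) by (auto simp: galois_group_def field_isom_def)
  interpret field_hom \<sigma> by fact
  obtain \<theta> r where \<theta>: "\<theta> \<noteq> 0" "\<theta>\<^sup>2 = \<iota> r" "\<And>v. \<exists>p q. v = \<iota> p + \<iota> q * \<theta>"
    using assms(2,3) by (rule quadratic_extension_generator) blast
  \<comment> \<open>\<open>\<sigma>\<close> permutes the square roots of \<open>\<iota> r\<close>;
    fixing \<open>\<theta>\<close> would make it the identity on all of L. Hence it negates
    \<open>\<theta>\<close> and is an involution.\<close>
  have "(\<sigma> \<theta>)\<^sup>2 = \<theta>\<^sup>2" using \<theta>(2) fix\<iota> by (metis hom_power)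
  hence "\<sigma> \<theta> = \<theta> \<or> \<sigma> \<theta> = - \<theta>" by (simp add: power2_eq_iff)
  moreover have "\<sigma> \<theta> \<noteq> \<theta>"
  proof
    assume eq: "\<sigma> \<theta> = \<theta>"
    have "\<sigma> v = v" for v
    proof -
      obtain p q where "v = \<iota> p + \<iota> q * \<theta>" using \<theta>(3) by blast
      thus ?thesis by (simp add: hom_distribs fix\<iota> eq)
    qed
    with \<open>\<sigma> \<noteq> id\<close> show False by auto
  qed
  ultimately have neg: "\<sigma> \<theta> = - \<theta>" by blast
  have invol: "\<sigma> (\<sigma> v) = v" for v
  proof -
    obtain p q where "v = \<iota> p + \<iota> q * \<theta>" using \<theta>(3) by blast
    thus ?thesis by (simp add: hom_distribs fix\<iota> neg)
  qed
  \<comment> \<open>Since the norm is multiplicative, only the products \<open>a * d\<close> and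
    \<open>b * c\<close> matter.\<close>
  have norm: "rel_norm \<sigma> a * rel_norm \<sigma> d - rel_norm \<sigma> b * rel_norm \<sigma> c =
      a * d * \<sigma> (a * d) - b * c * \<sigma> (b * c)"
    by (simp add: rel_norm_def hom_distribs)
  have "(\<exists>M \<in> C. det M = 0) \<longleftrightarrow> (\<exists>x y. x \<in> ring_of_integers - {0} \<and>
      y \<in> ring_of_integers - {0} \<and> a * x * (d * \<sigma> y) - b * \<sigma> x * (c * y) = 0)"
    unfolding assms(6) by (force simp: det_mat_of_rows_list_2)
  also have "\<dots> \<longleftrightarrow> a * d * \<sigma> (a * d) - b * c * \<sigma> (b * c) = 0"
  proof
    assume "\<exists>x y. x \<in> ring_of_integers - {0} \<and> y \<in> ring_of_integers - {0} \<and>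
      a * x * (d * \<sigma> y) - b * \<sigma> x * (c * y) = 0"
    then obtain x y where xy: "x \<noteq> 0" "y \<noteq> 0"
      and eq: "a * x * (d * \<sigma> y) - b * \<sigma> x * (c * y) = 0" by blast
    define w where "w = x * \<sigma> y"
    have "w * \<sigma> w \<noteq> 0" using xy by (simp add: w_def)
    have *: "a * d * w = b * c * \<sigma> w"
      using eq by (simp add: w_def hom_distribs invol algebra_simps)
    \<comment> \<open>The conjugate of \<open>*\<close>. Multiplying the two equations side by side
      compares norms, and the nonzero norm of \<open>w\<close> cancels.\<close>
    have "\<sigma> (a * d) * \<sigma> w = \<sigma> (b * c) * w"
      using arg_cong[OF *, of \<sigma>] by (simp add: hom_distribs invol)
    moreover have "(a * d * \<sigma> (a * d) - b * c * \<sigma> (b * c)) * (w * \<sigma> w) =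
        (a * d * w) * (\<sigma> (a * d) * \<sigma> w) - (b * c * \<sigma> w) * (\<sigma> (b * c) * w)"
      by (simp add: algebra_simps)
    ultimately have "(a * d * \<sigma> (a * d) - b * c * \<sigma> (b * c)) * (w * \<sigma> w) = 0"
      using * by simp
    thus "a * d * \<sigma> (a * d) - b * c * \<sigma> (b * c) = 0"
      using \<open>w * \<sigma> w \<noteq> 0\<close> by simp
  next
    assume eq: "a * d * \<sigma> (a * d) - b * c * \<sigma> (b * c) = 0"
    have "\<exists>t. t \<noteq> 0 \<and> a * d * t = b * c * \<sigma> t"
    proof (cases "a * d = 0")
      case True
      have "b * c * \<sigma> (b * c) = 0" using eq unfolding True by simp
      hence "b * c = 0" by (simp only: mult_eq_0_iff hom_0_iff) auto
      \<comment> \<open>Both products vanish, so any nonzero \<open>t\<close> would do.\<close>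
      with True have "(1 :: 'l) \<noteq> 0 \<and> a * d * 1 = b * c * \<sigma> 1"
        by (simp only: mult_zero_left) simp
      thus ?thesis by blast
    next
      case False
      \<comment> \<open>Equality of the norms says that this quotient has norm 1, and
        \<open>u * \<sigma> t = t\<close> is the desired equation divided by
        \<open>a * d\<close>.\<close>
      define u where "u = b * c / (a * d)"
      have "u * \<sigma> u = (b * c * \<sigma> (b * c)) / (a * d * \<sigma> (a * d))"
        by (simp add: u_def hom_distribs)
      also have "\<dots> = 1"
        using eq False by (metis divide_self eq_iff_diff_eq_0 hom_0_iff mult_eq_0_iff)
      finally have "u * \<sigma> u = 1" .
      then obtain t where "t \<noteq> 0" "u * \<sigma> t = t"
        using hilbert90_quadratic[OF \<sigma> invol neg \<theta>(1)] by blast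
      thus ?thesis using False by (intro exI[of _ t]) (simp add: u_def field_simps)
    qed
    then obtain t where t: "t \<noteq> 0" "a * d * t = b * c * \<sigma> t" by blast
    obtain n :: int where n: "n \<noteq> 0" "algebraic_int (of_int n * t)"
      using algebraic_imp_multiple_algebraic_int quadratic_tower_algebraic[OF assms(1-3)]
      by blast
    \<comment> \<open>\<open>\<sigma>\<close> fixes the integer \<open>n\<close>, so scaling
      \<open>t\<close> preserves the equation.\<close>
    have "a * (of_int n * t) * (d * \<sigma> 1) - b * \<sigma> (of_int n * t) * (c * 1) =
        of_int n * (a * d * t - b * c * \<sigma> t)"
      by (simp add: hom_distribs algebra_simps)
    thus "\<exists>x y. x \<in> ring_of_integers - {0} \<and> y \<in> ring_of_integers - {0} \<and>
        a * x * (d * \<sigma> y) - b * \<sigma> x * (c * y) = 0"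
      using n t by (intro exI[of _ "of_int n * t"] exI[of _ 1]) (simp add: ring_of_integers_def)
  qed
  finally show ?thesis by (simp add: det_mat_of_rows_list_2 norm)
qed

end
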